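(* Let $m\geq 2$ be an integer, let $k>0$, and let $G$ be a group of finite order $n$ such that no non-trivial representation of $G$ has dimension less than $k$. For each non-empty subset $F\subset\{1,2,\dots,m\}$ let $A_F$ be a subset of $G$ of density $p_F$, and suppose that this collection of sets satisfies the density condition. Then there exist elements $x_1,\dots,x_m$ of $G$ such that $x_F\in A_F$ for every non-empty $F\subset\{1,2,\dots,m\}$, where $x_F$ stands for the product of all $x_i$ such that $i\in F$, written with the indices in increasing order.
   Context: The density of a subset $A\subset G$ is $|A|/|G|$. Representations are finite-dimensional complex representations; a representation is non-trivial if some group element does not act as the identity. Density condition: let $1\leq h<m$ be an integer and let $E$ be a non-empty subset of $\{h+1,\dots,m\}$. Let $\mathcal{A}_{h,E}$ be the collection of all sets of the form $U\cup V$, where $U\subset\{1,\dots,h-1\}$ (possibly empty) and $V$ is one of $\{h\}$, $E$ or $\{h\}\cup E$. The sets $A_F$ satisfy the $(h,E)$-density condition if $\prod_{F\in\mathcal{A}_{h,E}}p_F\geq 2^{3m}/k$. They satisfy the density condition if they satisfy the $(h,E)$-density condition for every integer $h$ with $1\leq h<m$ and every non-empty set $E\subset\{h+1,\dots,m\}$. *)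

theory Defs
  imports "HOL-Algebra.Coset" "Jordan_Normal_Form.Matrix"
begin

text \<open>
  A representation on complex d-space, in coordinates: a homomorphism into the group of
  invertible complex matrices of size d. The last argument of \<open>ring_mat\<close> is a dummy
  record extension.
\<close>

definition GL :: "nat \<Rightarrow> complex mat monoid" where
  "GL d = units_of (ring_mat TYPE(complex) d ())"

definition representation :: "('a, 'b) monoid_scheme \<Rightarrow> nat \<Rightarrow> ('a \<Rightarrow> complex mat) \<Rightarrow> bool" where
  "representation G d \<rho> \<longleftrightarrow> \<rho> \<in> hom G (GL d)"

definition nontrivial_representation ::
    "('a, 'b) monoid_scheme \<Rightarrow> nat \<Rightarrow> ('a \<Rightarrow> complex mat) \<Rightarrow> bool" where
  "nontrivial_representation G d \<rho> \<longleftrightarrow>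
     representation G d \<rho> \<and> (\<exists>g\<in>carrier G. \<rho> g \<noteq> 1\<^sub>m d)"

definition density :: "('a, 'b) monoid_scheme \<Rightarrow> 'a set \<Rightarrow> real" where
  "density G A = real (card A) / real (order G)"

definition index_family :: "nat \<Rightarrow> nat set \<Rightarrow> nat set set" where
  "index_family h E = {U \<union> V | U V. U \<subseteq> {1..<h} \<and> V \<in> {{h}, E, {h} \<union> E}}"

definition hE_density_condition ::
    "('a, 'b) monoid_scheme \<Rightarrow> nat \<Rightarrow> real \<Rightarrow> (nat set \<Rightarrow> 'a set) \<Rightarrow> nat \<Rightarrow> nat set \<Rightarrow> bool" where
  "hE_density_condition G m k A h E \<longleftrightarrow>
     (\<Prod>F\<in>index_family h E. density G (A F)) \<ge> 2 ^ (3 * m) / k"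

definition density_condition ::
    "('a, 'b) monoid_scheme \<Rightarrow> nat \<Rightarrow> real \<Rightarrow> (nat set \<Rightarrow> 'a set) \<Rightarrow> bool" where
  "density_condition G m k A \<longleftrightarrow>
     (\<forall>h E. 1 \<le> h \<and> h < m \<and> E \<noteq> {} \<and> E \<subseteq> {h+1..m} \<longrightarrow> hE_density_condition G m k A h E)"

definition ordered_prod :: "('a, 'b) monoid_scheme \<Rightarrow> (nat \<Rightarrow> 'a) \<Rightarrow> nat set \<Rightarrow> 'a" where
  "ordered_prod G x F = foldr (\<otimes>\<^bsub>G\<^esub>) (map x (sorted_list_of_set F)) \<one>\<^bsub>G\<^esub>"

end

theory Submission
  imports "HOL-Analysis.Function_Topology" Defs
begin

text \<open>
  Convolution with a function \<open>\<phi>\<close> on \<open>G\<close>, restricted to functions with zero sum, has a largest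
  singular value whose singular vectors form a space invariant under translation. This space is a
  non-trivial representation, so its dimension is at least \<open>k\<close>; comparing with the
  Hilbert--Schmidt norm, the largest singular value is at most
  \<open>(n/k)\<^sup>1\<^sup>/\<^sup>2 \<parallel>\<phi>\<parallel>\<^sub>2\<close>. Hence, for sets \<open>A\<close> and \<open>B\<close> of densities \<open>a\<close> and \<open>b\<close>,
  the density of those \<open>x\<close> for which \<open>{y \<in> A. x y \<in> B}\<close> has density less than
  \<open>(1 - \<eta>) a b\<close> is at most \<open>1 / (\<eta>\<^sup>2 a b k)\<close>.

  The elements \<open>x\<^sub>1, x\<^sub>2, \<dots>\<close> are now chosen one after the other. Once \<open>x\<^sub>1, \<dots>, x\<^sub>j\<close> are
  fixed, each \<open>F \<subseteq> {j+1,\<dots>,m}\<close> comes with a set of values that \<open>x\<^sub>F\<close> may take. With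
  \<open>\<eta> = 2\<^sup>-\<^sup>m\<close> the density of this set stays at least
  \<open>(1 - \<eta>)\<close> to the power \<open>2\<^sup>j - 1\<close> times the product of the \<open>p\<^bsub>U\<union>F\<^esub>\<close> over
  \<open>U \<subseteq> {1,\<dots>,j}\<close>: the density condition ensures that the elements \<open>x\<^sub>j\<^sub>+\<^sub>1\<close>
  that are bad for some \<open>F\<close> cannot exhaust the admissible ones.
\<close>

section \<open>Orthonormal families of functions on a finite set\<close>

definition ip :: "'a set \<Rightarrow> ('a \<Rightarrow> real) \<Rightarrow> ('a \<Rightarrow> real) \<Rightarrow> real" where
  "ip S f g = (\<Sum>x\<in>S. f x * g x)"

lemma ip_commute: "ip S f g = ip S g f"
  by (simp add: ip_def mult.commute)

lemma ip_add_left: "ip S (\<lambda>x. f x + c * g x) h = ip S f h + c * ip S g h"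
  by (simp add: ip_def sum.distrib sum_distrib_left algebra_simps)

lemma ip_add_right: "ip S h (\<lambda>x. f x + c * g x) = ip S h f + c * ip S h g"
  by (metis ip_commute ip_add_left)

lemma ip_scale_left: "ip S (\<lambda>x. c * f x) h = c * ip S f h"
  by (simp add: ip_def sum_distrib_left algebra_simps)

lemma ip_scale_right: "ip S h (\<lambda>x. c * f x) = c * ip S h f"
  by (metis ip_commute ip_scale_left)

lemma ip_sum_left: "ip S (\<lambda>x. \<Sum>i\<in>I. c i * w i x) h = (\<Sum>i\<in>I. c i * ip S (w i) h)"
  unfolding ip_def sum_distrib_left sum_distrib_right
  by (subst sum.swap) (simp add: mult.assoc)

lemma ip_diff_left: "ip S (\<lambda>x. f x - g x) h = ip S f h - ip S g h"
  by (simp add: ip_def sum_subtractf algebra_simps)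

lemma ip_diff_right: "ip S h (\<lambda>x. f x - g x) = ip S h f - ip S h g"
  by (metis ip_commute ip_diff_left)

lemma ip_self_nonneg: "ip S f f \<ge> 0"
  by (simp add: ip_def sum_nonneg)

lemma ip_self_eq_0:
  assumes "finite S"
  shows "ip S f f = 0 \<longleftrightarrow> (\<forall>x\<in>S. f x = 0)"
  using assms by (simp add: ip_def sum_nonneg_eq_0_iff)

lemma ip_cong: "(\<And>x. x \<in> S \<Longrightarrow> f x = f' x) \<Longrightarrow> (\<And>x. x \<in> S \<Longrightarrow> g x = g' x) \<Longrightarrow> ip S f g = ip S f' g'"
  by (simp add: ip_def)

definition orthonormal :: "'a set \<Rightarrow> nat \<Rightarrow> (nat \<Rightarrow> 'a \<Rightarrow> real) \<Rightarrow> bool" where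
  "orthonormal S d w \<longleftrightarrow> (\<forall>i<d. \<forall>j<d. ip S (w i) (w j) = (if i = j then 1 else 0))"

lemma ip_residual:
  assumes "orthonormal S d w" and "j < d"
  shows "ip S (\<lambda>x. f x - (\<Sum>i<d. ip S f (w i) * w i x)) (w j) = 0"
proof -
  have "(\<Sum>i<d. ip S f (w i) * ip S (w i) (w j)) = (\<Sum>i<d. if i = j then ip S f (w i) else 0)"
    using assms by (intro sum.cong) (auto simp: orthonormal_def)
  then show ?thesis
    using assms(2) by (simp add: ip_diff_left ip_sum_left)
qed

lemma Bessel_inequality:
  assumes "orthonormal S d w"
  shows "(\<Sum>i<d. (ip S f (w i))\<^sup>2) \<le> ip S f f"
proof -
  let ?p = "\<lambda>x. \<Sum>i<d. ip S f (w i) * w i x"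
  let ?r = "\<lambda>x. f x - ?p x"
  have "ip S ?p ?r = 0"
    using ip_residual[OF assms] by (simp add: ip_sum_left ip_commute[of S "w _"])
  then have "ip S ?r ?r = ip S f ?r"
    by (subst ip_diff_left) simp
  also have "\<dots> = ip S f f - (\<Sum>i<d. (ip S f (w i))\<^sup>2)"
    by (simp add: ip_diff_right ip_commute[of S f ?p] ip_sum_left ip_commute[of S "w _"]
        power2_eq_square)
  finally show ?thesis
    using ip_self_nonneg[of S ?r] by linarith
qed

text \<open>After exchanging the sums, Bessel's inequality applies to each row \<open>K x\<close>.
  The right side is the squared Hilbert-Schmidt norm of the kernel.\<close>

lemma orthonormal_hilbert_schmidt_bound:
  assumes "orthonormal S d w"
  shows "(\<Sum>i<d. \<Sum>x\<in>X. (ip S (K x) (w i))\<^sup>2) \<le> (\<Sum>x\<in>X. ip S (K x) (K x))"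
  by (subst sum.swap) (intro sum_mono Bessel_inequality assms)

text \<open>For the identity kernel the Hilbert-Schmidt bound compares \<open>d\<close> with
  \<open>card S\<close>.\<close>

lemma orthonormal_card_le:
  assumes "finite S" and "orthonormal S d w"
  shows "d \<le> card S"
proof -
  let ?K = "\<lambda>x y. if y = x then 1 else (0::real)"
  have K: "ip S (?K x) f = f x" if "x \<in> S" for x f
  proof -
    have "ip S (?K x) f = (\<Sum>y\<in>S. if y = x then f y else 0)"
      unfolding ip_def by (intro sum.cong) auto
    then show ?thesis using that assms(1) by simp
  qed
  have "real d = (\<Sum>i<d. ip S (w i) (w i))"
    using assms(2) by (simp add: orthonormal_def)
  also have "\<dots> = (\<Sum>i<d. \<Sum>x\<in>S. (ip S (?K x) (w i))\<^sup>2)"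
    using K by (simp add: ip_def[of S "w _" "w _"] power2_eq_square)
  also have "\<dots> \<le> (\<Sum>x\<in>S. ip S (?K x) (?K x))"
    by (rule orthonormal_hilbert_schmidt_bound[OF assms(2)])
  also have "\<dots> = real (card S)"
    using K by simp
  finally show ?thesis by simp
qed

text \<open>A longest orthonormal family in \<open>W\<close> works: if some \<open>f\<close> in
  \<open>W\<close> were not expanded by it on \<open>S\<close>, the normalized residual would
  lengthen the family.\<close>

lemma orthonormal_basis_exists:
  fixes W :: "('a \<Rightarrow> real) set"
  assumes "finite S"
    and zero: "(\<lambda>x. 0) \<in> W"
    and lin: "\<And>f g c. f \<in> W \<Longrightarrow> g \<in> W \<Longrightarrow> (\<lambda>x. f x + c * g x) \<in> W"
  obtains d w where "orthonormal S d w" and "\<And>i. i < d \<Longrightarrow> w i \<in> W"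
    and "\<And>f x. f \<in> W \<Longrightarrow> x \<in> S \<Longrightarrow> f x = (\<Sum>i<d. ip S f (w i) * w i x)"
proof -
  let ?P = "\<lambda>d. \<exists>w. orthonormal S d w \<and> (\<forall>i<d. w i \<in> W)"
  let ?d = "GREATEST d. ?P d"
  have bound: "\<And>d. ?P d \<Longrightarrow> d \<le> card S"
    using orthonormal_card_le[OF \<open>finite S\<close>] by blast
  have "?P 0" by (simp add: orthonormal_def)
  then have "?P ?d"
    by (rule GreatestI_nat[where P = "?P"]) (rule bound)
  then obtain w where w: "orthonormal S ?d w" "\<And>i. i < ?d \<Longrightarrow> w i \<in> W" by blast
  have "\<forall>f\<in>W. \<forall>x\<in>S. f x = (\<Sum>i<?d. ip S f (w i) * w i x)"
  proof (intro ballI, rule ccontr)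
    fix f x
    assume f: "f \<in> W" and x: "x \<in> S"
    assume neq: "f x \<noteq> (\<Sum>i<?d. ip S f (w i) * w i x)"
    define r where "r = (\<lambda>x. f x - (\<Sum>i<?d. ip S f (w i) * w i x))"
    define c where "c = sqrt (ip S r r)"
    \<comment> \<open>Closure of \<open>W\<close> is given for one added term at a time, hence the
      induction over partial sums.\<close>
    have part: "(\<lambda>x. \<Sum>i<e. ip S f (w i) * w i x) \<in> W" if "e \<le> ?d" for e
      using that
    proof (induction e)
      case (Suc e)
      then show ?case
        using lin[of "\<lambda>x. \<Sum>i<e. ip S f (w i) * w i x" "w e" "ip S f (w e)"] w(2) by simp
    qed (simp add: zero)
    have "r \<in> W"
      using lin[OF f part[OF order_refl], of "-1"] by (simp add: r_def)
    have "ip S r r \<noteq> 0"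
      using neq x by (auto simp: ip_self_eq_0[OF \<open>finite S\<close>] r_def)
    then have c: "c > 0" "c * c = ip S r r"
      using ip_self_nonneg[of S r] by (auto simp: c_def)
    define u where "u = (\<lambda>x. (1 / c) * r x)"
    have "u \<in> W"
      using lin[OF zero \<open>r \<in> W\<close>, of "1 / c"] by (simp add: u_def)
    have uu: "ip S u u = 1"
      unfolding u_def ip_scale_left ip_scale_right using c(1) by (simp flip: c(2))
    have uw: "ip S u (w i) = 0" if "i < ?d" for i
      unfolding u_def ip_scale_left using ip_residual[OF w(1) that, of f] by (simp add: r_def)
    have "orthonormal S (Suc ?d) (w(?d := u))"
      using w(1) uu uw by (auto simp: orthonormal_def less_Suc_eq ip_commute[of S "w _" u])
    moreover have "\<forall>i<Suc ?d. (w(?d := u)) i \<in> W"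
      using w(2) \<open>u \<in> W\<close> by (auto simp: less_Suc_eq)
    ultimately have "?P (Suc ?d)" by blast
    then have "Suc ?d \<le> ?d"
      by (rule Greatest_le_nat[where P = "?P"]) (rule bound)
    then show False by simp
  qed
  then show thesis
    by (intro that[OF w]) blast+
qed

section \<open>The norm of a kernel on the functions with zero sum\<close>

text \<open>The maximum is attained because the unit sphere of zero-sum functions is compact;
  \<open>f0\<close> guarantees that this sphere is non-empty.\<close>

lemma zero_sum_maximizer:
  fixes K :: "'b \<Rightarrow> 'a \<Rightarrow> real"
  assumes "finite S" and "(\<Sum>x\<in>S. f0 x) = 0" and "ip S f0 f0 \<noteq> 0"
  obtains f where "(\<Sum>x\<in>S. f x) = 0" and "ip S f f = 1"
    and "\<And>g. (\<Sum>x\<in>S. g x) = 0 \<Longrightarrow>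
           (\<Sum>x\<in>X. (ip S (K x) g)\<^sup>2) \<le> (\<Sum>x\<in>X. (ip S (K x) f)\<^sup>2) * ip S g g"
proof -
  define q where "q = (\<lambda>f. \<Sum>x\<in>X. (ip S (K x) f)\<^sup>2)"
  \<comment> \<open>Functions live on the whole type, so their values off \<open>S\<close> are
    pinned to 0. This makes the product of the coordinate ranges compact by Tychonoff's
    theorem.\<close>
  define box where "box = Pi\<^sub>E UNIV (\<lambda>x. if x \<in> S then {-1..1} else {0::real})"
  define C where "C = box \<inter> {f. (\<Sum>x\<in>S. f x) = 0} \<inter> {f. ip S f f = 1}"
  have cont_coord: "continuous_on T (\<lambda>f. f x)" for T :: "('a \<Rightarrow> real) set" and x
    by (rule continuous_on_subset[OF continuous_on_product_coordinates subset_UNIV])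
  have "compactin (product_topology (\<lambda>i. euclidean) UNIV) box"
    unfolding box_def by (subst compactin_PiE) auto
  then have "compact box"
    by (simp add: euclidean_product_topology)
  moreover have "closed {f. (\<Sum>x\<in>S. f x) = (0::real)}"
    by (intro closed_Collect_eq continuous_intros cont_coord)
  moreover have "closed {f. ip S f f = 1}"
    unfolding ip_def by (intro closed_Collect_eq continuous_intros cont_coord)
  ultimately have "compact C"
    unfolding C_def by (intro compact_Int_closed)
  \<comment> \<open>Rescaling to norm 1 and cutting off outside \<open>S\<close> lands in
    \<open>C\<close>. As \<open>q\<close> is quadratic, its maximum on \<open>C\<close> controls
    every zero-sum function of non-zero norm.\<close>
  have normalize: "\<exists>h\<in>C. q g = q h * ip S g g"
    if g: "(\<Sum>x\<in>S. g x) = 0" "ip S g g \<noteq> 0" for g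
  proof -
    define c where "c = sqrt (ip S g g)"
    have c: "c > 0" "c * c = ip S g g"
      using g ip_self_nonneg[of S g] by (auto simp: c_def)
    define h where "h = (\<lambda>x. if x \<in> S then (1 / c) * g x else 0)"
    have ip_h: "ip S u h = ip S u g / c" for u
      using ip_cong[of S u u h "\<lambda>x. (1 / c) * g x"] ip_scale_right[of S u "1 / c" g]
      by (simp add: h_def)
    have "ip S h h = 1"
      using ip_h[of h] ip_h[of g] c(1) by (simp add: ip_commute[of S h g] flip: c(2))
    have "-1 \<le> h x \<and> h x \<le> 1" if "x \<in> S" for x
    proof -
      have "(h x)\<^sup>2 \<le> (\<Sum>x\<in>S. (h x)\<^sup>2)"
        using that \<open>finite S\<close> by (intro member_le_sum) auto
      with \<open>ip S h h = 1\<close> have "(h x)\<^sup>2 \<le> 1"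
        by (simp add: ip_def power2_eq_square)
      then have "\<bar>h x\<bar> \<le> 1"
        by (simp only: abs_square_le_1)
      then show ?thesis by linarith
    qed
    then have "h \<in> box"
      by (auto simp: box_def h_def)
    moreover have "(\<Sum>x\<in>S. h x) = 0"
      using g(1) by (simp add: h_def flip: sum_divide_distrib)
    moreover have "q g = q h * ip S g g"
      using c(1) by (simp add: q_def ip_h power_divide power2_eq_square sum_distrib_right flip: c(2))
    ultimately show ?thesis
      using \<open>ip S h h = 1\<close> by (auto simp: C_def)
  qed
  from normalize[OF assms(2,3)] have "C \<noteq> {}" by blast
  moreover have "continuous_on C q"
    unfolding q_def ip_def by (intro continuous_intros cont_coord)
  ultimately obtain f where f: "f \<in> C" "\<And>h. h \<in> C \<Longrightarrow> q h \<le> q f"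
    using continuous_attains_sup[OF \<open>compact C\<close>] by blast
  have "q g \<le> q f * ip S g g" if "(\<Sum>x\<in>S. g x) = 0" for g
  proof (cases "ip S g g = 0")
    case True
    then have "\<forall>x\<in>S. g x = 0"
      by (simp add: ip_self_eq_0[OF \<open>finite S\<close>])
    with True show ?thesis by (simp add: q_def ip_def)
  next
    case False
    then show ?thesis
      using normalize[OF that False] f(2) ip_self_nonneg[of S g] by (auto intro: mult_right_mono)
  qed
  with f(1) show thesis
    by (intro that[of f]) (auto simp: C_def q_def)
qed

section \<open>Convolution on a group without small representations\<close>

context group
begin

section \<open>Left translation on an invariant space as a matrix representation\<close>

lemma sum_left_translate:
  assumes "g \<in> carrier G"
  shows "(\<Sum>x\<in>carrier G. F (g \<otimes> x)) = (\<Sum>x\<in>carrier G. F x)"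
  by (rule sum.reindex_bij_witness[where i = "\<lambda>x. inv g \<otimes> x" and j = "\<lambda>x. g \<otimes> x"])
    (use assms in \<open>simp_all flip: m_assoc\<close>)

lemma sum_right_translate:
  assumes "g \<in> carrier G"
  shows "(\<Sum>x\<in>carrier G. F (x \<otimes> g)) = (\<Sum>x\<in>carrier G. F x)"
  by (rule sum.reindex_bij_witness[where i = "\<lambda>x. x \<otimes> inv g" and j = "\<lambda>x. x \<otimes> g"])
    (use assms in \<open>simp_all add: m_assoc\<close>)

text \<open>For orthonormal \<open>w\<close> this is the coefficient of \<open>w i\<close> in the
  translate of \<open>w j\<close> by \<open>g\<close>. The inverse makes \<open>g\<close> act from
  the left, so group products become matrix products in the same order.\<close>

definition translation_coeff :: "(nat \<Rightarrow> 'a \<Rightarrow> real) \<Rightarrow> 'a \<Rightarrow> nat \<Rightarrow> nat \<Rightarrow> real" where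
  "translation_coeff w g i j = ip (carrier G) (\<lambda>x. w j (inv g \<otimes> x)) (w i)"

definition translation_rep :: "nat \<Rightarrow> (nat \<Rightarrow> 'a \<Rightarrow> real) \<Rightarrow> 'a \<Rightarrow> complex mat" where
  "translation_rep d w g = mat d d (\<lambda>(i, j). complex_of_real (translation_coeff w g i j))"

context
  fixes d :: nat and w :: "nat \<Rightarrow> 'a \<Rightarrow> real"
  assumes orthonormal: "orthonormal (carrier G) d w"
    and invariant: "\<And>g x j. g \<in> carrier G \<Longrightarrow> x \<in> carrier G \<Longrightarrow> j < d \<Longrightarrow>
      w j (inv g \<otimes> x) = (\<Sum>i<d. translation_coeff w g i j * w i x)"
begin

lemma translation_coeff_one:
  assumes "i < d" and "j < d"
  shows "translation_coeff w \<one> i j = (if i = j then 1 else 0)"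
proof -
  have "translation_coeff w \<one> i j = ip (carrier G) (w j) (w i)"
    unfolding translation_coeff_def by (rule ip_cong) auto
  with orthonormal assms show ?thesis by (simp add: orthonormal_def)
qed

text \<open>Translating by \<open>g \<otimes> h\<close> means translating by \<open>h\<close>, then
  by \<open>g\<close>: expand the translate of \<open>w j\<close> by \<open>h\<close> at the point
  \<open>inv g \<otimes> x\<close>, then pair with \<open>w i\<close>.\<close>

lemma translation_coeff_mult:
  assumes "g \<in> carrier G" and "h \<in> carrier G" and "j < d"
  shows "translation_coeff w (g \<otimes> h) i j =
    (\<Sum>l<d. translation_coeff w g i l * translation_coeff w h l j)"
proof -
  have "w j (inv (g \<otimes> h) \<otimes> x) = (\<Sum>l<d. translation_coeff w h l j * w l (inv g \<otimes> x))"
    if "x \<in> carrier G" for x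
    using that assms invariant[of h "inv g \<otimes> x" j] by (simp add: inv_mult_group m_assoc)
  then have "translation_coeff w (g \<otimes> h) i j =
      ip (carrier G) (\<lambda>x. \<Sum>l<d. translation_coeff w h l j * w l (inv g \<otimes> x)) (w i)"
    unfolding translation_coeff_def by (intro ip_cong) auto
  then show ?thesis
    unfolding ip_sum_left by (simp add: translation_coeff_def[of w g] mult.commute)
qed

lemma translation_rep_one: "translation_rep d w \<one> = 1\<^sub>m d"
  by (rule eq_matI) (auto simp: translation_rep_def translation_coeff_one)

lemma translation_rep_mult:
  assumes "g \<in> carrier G" and "h \<in> carrier G"
  shows "translation_rep d w (g \<otimes> h) = translation_rep d w g * translation_rep d w h"
  by (rule eq_matI)
    (auto simp: translation_rep_def scalar_prod_def translation_coeff_mult assms atLeast0LessThan)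

lemma representation_translation_rep: "representation G d (translation_rep d w)"
proof -
  have inverse: "translation_rep d w g * translation_rep d w h = 1\<^sub>m d"
    if "g \<in> carrier G" "h \<in> carrier G" "g \<otimes> h = \<one>" for g h
    using that by (simp add: translation_rep_one flip: translation_rep_mult)
  have "translation_rep d w g \<in> Units (ring_mat TYPE(complex) d ())" if "g \<in> carrier G" for g
    unfolding Units_def ring_mat_simps
    using inverse[of "inv g" g] inverse[of g "inv g"] that
    by (auto intro!: bexI[of _ "translation_rep d w (inv g)"] simp: translation_rep_def)
  then show ?thesis
    by (auto simp: representation_def GL_def hom_def units_of_def ring_mat_simps
        translation_rep_mult)
qed

text \<open>If every translation acted as the identity, \<open>w 0\<close> would be constant on the
  group; a constant with zero sum vanishes, contrary to norm 1.\<close>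

lemma nontrivial_translation_rep:
  assumes "finite (carrier G)" and "d > 0" and "\<And>i. i < d \<Longrightarrow> (\<Sum>x\<in>carrier G. w i x) = 0"
  shows "nontrivial_representation G d (translation_rep d w)"
proof (rule ccontr)
  assume "\<not> ?thesis"
  with representation_translation_rep
  have trivial: "translation_rep d w g = 1\<^sub>m d" if "g \<in> carrier G" for g
    using that by (auto simp: nontrivial_representation_def)
  have coeff: "translation_coeff w g i 0 = (if i = 0 then 1 else 0)"
    if "g \<in> carrier G" "i < d" for g i
  proof -
    have "complex_of_real (translation_coeff w g i 0) = translation_rep d w g $$ (i, 0)"
      using that \<open>d > 0\<close> by (simp add: translation_rep_def)
    also have "\<dots> = (if i = 0 then 1 else 0)"
      using that \<open>d > 0\<close> by (simp add: trivial)
    finally show ?thesis by (simp split: if_splits)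
  qed
  have const: "w 0 g = w 0 \<one>" if "g \<in> carrier G" for g
  proof -
    have "w 0 (inv g \<otimes> g) = (\<Sum>i<d. translation_coeff w g i 0 * w i g)"
      using that \<open>d > 0\<close> by (intro invariant) auto
    also have "\<dots> = (\<Sum>i<d. if i = 0 then w i g else 0)"
      using that by (intro sum.cong) (auto simp: coeff)
    finally show ?thesis using that \<open>d > 0\<close> by simp
  qed
  have "0 = (\<Sum>x\<in>carrier G. w 0 x)"
    using assms by simp
  also have "\<dots> = (\<Sum>x\<in>carrier G. w 0 \<one>)"
    by (rule sum.cong[OF refl const])
  finally have "w 0 \<one> = 0"
    using \<open>finite (carrier G)\<close> by (auto simp: card_eq_0_iff)
  then have "\<forall>x\<in>carrier G. w 0 x = 0"
    using const by metis
  then have "ip (carrier G) (w 0) (w 0) = 0"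
    by (simp add: ip_def)
  with orthonormal \<open>d > 0\<close> show False by (simp add: orthonormal_def)
qed

end

lemma zero_sum_convolution_bound:
  fixes \<phi> f :: "'a \<Rightarrow> real"
  assumes fin: "finite (carrier G)" and "k > 0"
    and rep: "\<And>d \<rho>. nontrivial_representation G d \<rho> \<Longrightarrow> k \<le> real d"
    and f: "(\<Sum>x\<in>carrier G. f x) = 0"
  shows "(\<Sum>x\<in>carrier G. (\<Sum>y\<in>carrier G. \<phi> (x \<otimes> y) * f y)\<^sup>2)
    \<le> real (order G) / k * (\<Sum>x\<in>carrier G. (\<phi> x)\<^sup>2) * (\<Sum>x\<in>carrier G. (f x)\<^sup>2)"
proof -
  define S where "S = carrier G"
  have "finite S" using fin by (simp add: S_def)
  define T where "T = (\<lambda>f x. ip S (\<lambda>y. \<phi> (x \<otimes> y)) f)"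
  define q where "q = (\<lambda>f. ip S (T f) (T f))"
  define V where "V = {f. (\<Sum>x\<in>S. f x) = (0::real)}"
  define N where "N = (\<Sum>x\<in>S. (\<phi> x)\<^sup>2)"
  have "N \<ge> 0" by (simp add: N_def sum_nonneg)
  have T_lin: "T (\<lambda>x. u x + c * v x) = (\<lambda>x. T u x + c * T v x)" for u v c
    by (simp add: T_def ip_add_right)
  have "q f \<le> real (order G) / k * N * ip S f f"
  proof (cases "ip S f f = 0")
    case True
    then have "\<forall>x\<in>S. f x = 0"
      by (simp add: ip_self_eq_0[OF \<open>finite S\<close>])
    with True show ?thesis by (simp add: q_def T_def ip_def)
  next
    case False
    have q: "q u = (\<Sum>x\<in>S. (ip S (\<lambda>y. \<phi> (x \<otimes> y)) u)\<^sup>2)" for u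
      unfolding q_def ip_def[of S "T u" "T u"] by (simp add: T_def power2_eq_square)
    obtain f0 where "(\<Sum>x\<in>S. f0 x) = 0" and f0_norm: "ip S f0 f0 = 1"
      and "\<And>g. (\<Sum>x\<in>S. g x) = 0 \<Longrightarrow> q g \<le> q f0 * ip S g g"
      unfolding q
      by (rule zero_sum_maximizer[OF \<open>finite S\<close> _ False,
            where X = S and K = "\<lambda>x y. \<phi> (x \<otimes> y)"])
        (use f in \<open>auto simp: S_def\<close>)
    then have f0: "f0 \<in> V" and max: "\<And>g. g \<in> V \<Longrightarrow> q g \<le> q f0 * ip S g g"
      by (auto simp: V_def)
    define \<mu> where "\<mu> = q f0"
    \<comment> \<open>On \<open>V\<close> the form \<open>D\<close> is positive semidefinite because
      \<open>\<mu>\<close> is the maximum of \<open>q\<close> on the unit sphere. Its radical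
      \<open>W\<close> consists of the top singular vectors of \<open>T\<close> on \<open>V\<close>,
      together with zero.\<close>
    define D where "D = (\<lambda>u v. \<mu> * ip S u v - ip S (T u) (T v))"
    define W where "W = {u \<in> V. \<forall>v\<in>V. D u v = 0}"
    have V_lin: "(\<lambda>x. u x + c * v x) \<in> V" if "u \<in> V" "v \<in> V" for u v c
      using that by (simp add: V_def sum.distrib flip: sum_distrib_left)
    have D_nonneg: "D u u \<ge> 0" if "u \<in> V" for u
      using max[OF that] by (simp add: D_def \<mu>_def q_def)
    have D_commute: "D u v = D v u" for u v
      by (simp add: D_def ip_commute)
    have D_add: "D (\<lambda>x. u x + c * v x) h = D u h + c * D v h" for u v c h
      by (simp add: D_def T_lin ip_add_left algebra_simps)
    have W_I: "u \<in> W" if u: "u \<in> V" "D u u = 0" for u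
    proof -
      have "D u v = 0" if v: "v \<in> V" for v
      proof (rule ccontr)
        assume ne: "D u v \<noteq> 0"
        \<comment> \<open>A null vector of a positive semidefinite form lies in its radical: this
          \<open>c\<close> would make the quadratic value at \<open>v + c * u\<close> equal to
          -1.\<close>
        define c where "c = - (D v v + 1) / (2 * D u v)"
        have "0 \<le> D (\<lambda>x. v x + c * u x) (\<lambda>x. v x + c * u x)"
          by (intro D_nonneg V_lin u v)
        also have "\<dots> = D v v + 2 * c * D u v"
          using u by (simp add: D_add D_commute[of _ "\<lambda>x. v x + c * u x"] D_commute[of v u])
        also have "\<dots> = -1"
          using ne by (simp add: c_def field_simps)
        finally show False by simp
      qed
      with u show ?thesis by (simp add: W_def)
    qed
    have "f0 \<in> W"
      using f0 f0_norm by (intro W_I) (auto simp: D_def \<mu>_def q_def)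
    have W_translate: "(\<lambda>x. u (inv g \<otimes> x)) \<in> W" if u: "u \<in> W" and g: "g \<in> carrier G" for u g
    proof (rule W_I)
      let ?u = "\<lambda>x. u (inv g \<otimes> x)"
      show "?u \<in> V"
        using u g sum_left_translate[of "inv g" u] by (simp add: W_def V_def S_def)
      \<comment> \<open>Substituting \<open>inv g \<otimes> y\<close> for \<open>y\<close> turns a
        left translation of \<open>u\<close> into a right translation of \<open>T u\<close>, so
        neither norm occurring in \<open>D\<close> changes.\<close>
      have T_u: "T ?u x = T u (x \<otimes> g)" if "x \<in> S" for x
      proof -
        have "T u (x \<otimes> g) = (\<Sum>y\<in>carrier G. \<phi> (x \<otimes> g \<otimes> (inv g \<otimes> y)) * u (inv g \<otimes> y))"
          unfolding T_def ip_def S_def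
          using g sum_left_translate[of "inv g" "\<lambda>y. \<phi> (x \<otimes> g \<otimes> y) * u y"] by simp
        also have "\<dots> = T ?u x"
          unfolding T_def ip_def S_def
        proof (intro sum.cong refl)
          fix y assume "y \<in> carrier G"
          then have "x \<otimes> g \<otimes> (inv g \<otimes> y) = x \<otimes> y"
            using g that by (metis S_def inv_closed m_assoc m_closed r_inv l_one)
          then show "\<phi> (x \<otimes> g \<otimes> (inv g \<otimes> y)) * u (inv g \<otimes> y) = \<phi> (x \<otimes> y) * u (inv g \<otimes> y)"
            by simp
        qed
        finally show ?thesis ..
      qed
      have "ip S (T ?u) (T ?u) = ip S (\<lambda>x. T u (x \<otimes> g)) (\<lambda>x. T u (x \<otimes> g))"
        by (rule ip_cong) (simp_all add: T_u)
      also have "\<dots> = ip S (T u) (T u)"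
        using g sum_right_translate[of g "\<lambda>x. T u x * T u x"] by (simp add: ip_def S_def)
      finally have "ip S (T ?u) (T ?u) = ip S (T u) (T u)" .
      moreover have "ip S ?u ?u = ip S u u"
        using g sum_left_translate[of "inv g" "\<lambda>x. u x * u x"] by (simp add: ip_def S_def)
      ultimately have "D ?u ?u = D u u"
        by (simp add: D_def)
      with u show "D ?u ?u = 0" by (simp add: W_def)
    qed
    have zero: "(\<lambda>x. 0) \<in> W"
      by (intro W_I) (auto simp: V_def D_def T_def ip_def)
    have lin: "(\<lambda>x. u x + c * v x) \<in> W" if "u \<in> W" "v \<in> W" for u v c
      using that by (auto simp: W_def V_lin D_add)
    obtain d w where w: "orthonormal S d w" "\<And>i. i < d \<Longrightarrow> w i \<in> W"
      and expand: "\<And>u x. u \<in> W \<Longrightarrow> x \<in> S \<Longrightarrow> u x = (\<Sum>i<d. ip S u (w i) * w i x)"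
      using orthonormal_basis_exists[OF \<open>finite S\<close> zero lin] by blast
    have "d > 0"
    proof (rule ccontr)
      assume "\<not> d > 0"
      then have "\<forall>x\<in>S. f0 x = 0" using expand[OF \<open>f0 \<in> W\<close>] by simp
      with f0_norm show False by (simp add: ip_def)
    qed
    have "nontrivial_representation G d (translation_rep d w)"
    proof (rule nontrivial_translation_rep[OF _ _ fin \<open>d > 0\<close>])
      show "orthonormal (carrier G) d w" using w(1) by (simp add: S_def)
      show "w j (inv g \<otimes> x) = (\<Sum>i<d. translation_coeff w g i j * w i x)"
        if "g \<in> carrier G" "x \<in> carrier G" "j < d" for g x j
        unfolding translation_coeff_def
        using expand[OF W_translate[OF w(2)], of j g x] that by (simp add: S_def)
      show "(\<Sum>x\<in>carrier G. w i x) = 0" if "i < d" for i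
        using w(2)[OF that] by (simp add: W_def V_def S_def)
    qed
    then have "k \<le> real d" by (rule rep)
    have "\<mu> \<ge> 0" by (simp add: \<mu>_def q_def ip_self_nonneg)
    have "ip S (T (w i)) (T (w i)) = \<mu>" if "i < d" for i
    proof -
      have "D (w i) (w i) = 0"
        using w(2)[OF that] by (simp add: W_def)
      moreover have "ip S (w i) (w i) = 1"
        using w(1) that by (simp add: orthonormal_def)
      ultimately show ?thesis by (simp add: D_def)
    qed
    \<comment> \<open>Each of the \<open>d\<close> basis vectors contributes \<open>\<mu>\<close>,
      while each row of the kernel is a translate of \<open>\<phi>\<close> with squared norm
      \<open>N\<close>. With \<open>k \<le> real d\<close> this bounds \<open>\<mu>\<close>.\<close>
    then have "real d * \<mu> = (\<Sum>i<d. ip S (T (w i)) (T (w i)))"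
      by simp
    also have "\<dots> \<le> (\<Sum>x\<in>S. ip S (\<lambda>y. \<phi> (x \<otimes> y)) (\<lambda>y. \<phi> (x \<otimes> y)))"
      using orthonormal_hilbert_schmidt_bound[OF w(1), where X = S and K = "\<lambda>x y. \<phi> (x \<otimes> y)"]
      by (simp add: q[unfolded q_def])
    also have "\<dots> = (\<Sum>x\<in>S. N)"
      using sum_left_translate[of _ "\<lambda>y. \<phi> y * \<phi> y"]
      by (intro sum.cong) (auto simp: S_def ip_def N_def power2_eq_square)
    also have "\<dots> = real (order G) * N"
      by (simp add: S_def order_def)
    finally have "real d * \<mu> \<le> real (order G) * N" .
    moreover have "k * \<mu> \<le> real d * \<mu>"
      using \<open>k \<le> real d\<close> \<open>\<mu> \<ge> 0\<close> by (rule mult_right_mono)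
    ultimately have "\<mu> \<le> real (order G) / k * N"
      using \<open>k > 0\<close> by (simp add: field_simps)
    then have "\<mu> * ip S f f \<le> real (order G) / k * N * ip S f f"
      using ip_self_nonneg by (rule mult_right_mono)
    moreover have "q f \<le> \<mu> * ip S f f"
      using max[of f] f by (simp add: \<mu>_def V_def S_def)
    ultimately show ?thesis by simp
  qed
  then show ?thesis
    by (simp add: q_def T_def ip_def S_def N_def power2_eq_square)
qed

end

section \<open>Density of intersections with translates\<close>

lemma density_nonneg: "density G A \<ge> 0"
  by (simp add: density_def)

context group
begin

text \<open>A Chebyshev argument: convolving the indicator of \<open>B\<close> with the balanced
  indicator of \<open>A\<close> measures the deviation from the expected density, and the second
  moment of this deviation is small.\<close>

lemma density_bad_translates:
  assumes fin: "finite (carrier G)" and "k > 0"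
    and rep: "\<And>d \<rho>. nontrivial_representation G d \<rho> \<Longrightarrow> k \<le> real d"
    and A: "A \<subseteq> carrier G" and B: "B \<subseteq> carrier G"
    and pos: "density G A > 0" "density G B > 0" and "\<eta> \<ge> 0"
  shows "density G {x \<in> carrier G.
      density G {y \<in> A. x \<otimes> y \<in> B} < (1 - \<eta>) * (density G A * density G B)}
    * (\<eta>\<^sup>2 * density G A * density G B * k) \<le> 1"
    (is "density G ?bad * _ \<le> 1")
proof -
  define n where "n = real (order G)"
  define a where "a = density G A"
  define b where "b = density G B"
  define \<phi> where "\<phi> = (\<lambda>x. of_bool (x \<in> B) :: real)"
  \<comment> \<open>Subtracting the density \<open>a\<close> gives \<open>f\<close> zero sum, as
    \<open>zero_sum_convolution_bound\<close> requires.\<close>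
  define f where "f = (\<lambda>x. of_bool (x \<in> A) - a)"
  define c where "c = (\<lambda>x. \<Sum>y\<in>carrier G. \<phi> (x \<otimes> y) * f y)"
  have "a > 0" "b > 0" using pos by (simp_all add: a_def b_def)
  have n: "n > 0"
    using fin order_gt_0_iff_finite by (simp add: n_def)
  have a: "real (card A) = n * a" and b: "real (card B) = n * b"
    and dens: "real (card X) = n * density G X" for X
    using n by (simp_all add: a_def b_def density_def n_def)
  have count: "(\<Sum>x\<in>carrier G. of_bool (x \<in> X)) = real (card X)" if "X \<subseteq> carrier G" for X
    using that fin by (simp add: sum_of_bool_eq Int_absorb1)
  have f0: "(\<Sum>x\<in>carrier G. f x) = 0"
    using count[OF A] a by (simp add: f_def sum_subtractf n_def order_def)
  have f2: "(\<Sum>x\<in>carrier G. (f x)\<^sup>2) \<le> n * a"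
  proof -
    \<comment> \<open>Indicators are idempotent, and the last term is a multiple of
      \<open>f\<close>, so it drops out on summing.\<close>
    have "(f x)\<^sup>2 = of_bool (x \<in> A) - a * of_bool (x \<in> A) - a * f x" for x
      by (auto simp: f_def power2_eq_square algebra_simps)
    then have "(\<Sum>x\<in>carrier G. (f x)\<^sup>2) = n * a - a * (n * a)"
      using count[OF A] a f0 by (simp add: sum_subtractf flip: sum_distrib_left)
    with n \<open>a > 0\<close> show ?thesis by simp
  qed
  have \<phi>2: "(\<Sum>x\<in>carrier G. (\<phi> x)\<^sup>2) = n * b"
  proof -
    have "(\<phi> x)\<^sup>2 = \<phi> x" for x
      by (simp add: \<phi>_def)
    then show ?thesis
      using count[OF B] b by (simp add: \<phi>_def)
  qed
  have c: "c x = n * density G {y \<in> A. x \<otimes> y \<in> B} - n * (a * b)" if x: "x \<in> carrier G" for x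
  proof -
    have "\<phi> (x \<otimes> y) * f y = of_bool (y \<in> {y \<in> A. x \<otimes> y \<in> B}) - a * \<phi> (x \<otimes> y)" for y
      by (auto simp: \<phi>_def f_def)
    then have "c x = (\<Sum>y\<in>carrier G. of_bool (y \<in> {y \<in> A. x \<otimes> y \<in> B}) - a * \<phi> (x \<otimes> y))"
      by (simp only: c_def)
    also have "\<dots> = real (card {y \<in> A. x \<otimes> y \<in> B}) - a * (\<Sum>y\<in>carrier G. \<phi> (x \<otimes> y))"
      unfolding sum_subtractf sum_distrib_left by (subst count) (use A in auto)
    also have "(\<Sum>y\<in>carrier G. \<phi> (x \<otimes> y)) = n * b"
      using sum_left_translate[OF x, of \<phi>] count[OF B] b by (simp add: \<phi>_def)
    finally show ?thesis by (simp add: dens)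
  qed
  have "(\<eta> * n * (a * b))\<^sup>2 \<le> (c x)\<^sup>2" if "x \<in> ?bad" for x
  proof -
    have "n * density G {y \<in> A. x \<otimes> y \<in> B} \<le> n * ((1 - \<eta>) * (a * b))"
      using that n by (simp add: a_def b_def)
    then have "\<eta> * n * (a * b) \<le> - c x"
      using that by (simp add: c algebra_simps)
    then have "(\<eta> * n * (a * b))\<^sup>2 \<le> (- c x)\<^sup>2"
      using n pos \<open>\<eta> \<ge> 0\<close> by (intro power_mono) (auto simp: a_def b_def)
    then show ?thesis by simp
  qed
  then have "real (card ?bad) * (\<eta> * n * (a * b))\<^sup>2 \<le> (\<Sum>x\<in>?bad. (c x)\<^sup>2)"
    by (rule sum_bounded_below)
  also have "\<dots> \<le> (\<Sum>x\<in>carrier G. (c x)\<^sup>2)"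
    using fin by (intro sum_mono2) auto
  also have "\<dots> \<le> n / k * (\<Sum>x\<in>carrier G. (\<phi> x)\<^sup>2) * (\<Sum>x\<in>carrier G. (f x)\<^sup>2)"
    unfolding c_def n_def by (rule zero_sum_convolution_bound[OF fin \<open>k > 0\<close> rep f0])
  also have "\<dots> \<le> n / k * (n * b) * (n * a)"
    unfolding \<phi>2 using n pos \<open>k > 0\<close> f2 by (intro mult_left_mono) (auto simp: b_def)
  finally have *: "n * density G ?bad * (\<eta> * n * (a * b))\<^sup>2 \<le> n / k * (n * b) * (n * a)"
    by (simp only: dens)
  \<comment> \<open>The positive factor \<open>n ^ 3 * a * b\<close> is split off on both sides, and
    cancelling it gives the claim.\<close>
  have "(n ^ 3 * a * b) * (density G ?bad * (\<eta>\<^sup>2 * a * b * k))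
      = k * (n * density G ?bad * (\<eta> * n * (a * b))\<^sup>2)"
    by (simp add: power2_eq_square power3_eq_cube)
  also have "\<dots> \<le> k * (n / k * (n * b) * (n * a))"
    using * \<open>k > 0\<close> by (intro mult_left_mono) auto
  also have "\<dots> = (n ^ 3 * a * b) * 1"
    using \<open>k > 0\<close> by (simp add: power3_eq_cube)
  finally have "(n ^ 3 * a * b) * (density G ?bad * (\<eta>\<^sup>2 * a * b * k)) \<le> (n ^ 3 * a * b) * 1" .
  moreover have "n ^ 3 * a * b > 0"
    using n \<open>a > 0\<close> \<open>b > 0\<close> by simp
  ultimately show ?thesis
    unfolding a_def b_def by (simp only: mult_le_cancel_left_pos)
qed

text \<open>A union bound: by \<open>density_bad_translates\<close> each bad set has density below
  that of \<open>C\<close> divided by \<open>card I\<close>, so the bad sets cannot cover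
  \<open>C\<close>.\<close>

lemma good_translate_exists:
  fixes A B :: "'i \<Rightarrow> 'a set"
  assumes fin: "finite (carrier G)" and "k > 0"
    and rep: "\<And>d \<rho>. nontrivial_representation G d \<rho> \<Longrightarrow> k \<le> real d"
    and I: "finite I" "I \<noteq> {}" and C: "C \<subseteq> carrier G"
    and sub: "\<And>i. i \<in> I \<Longrightarrow> A i \<subseteq> carrier G" "\<And>i. i \<in> I \<Longrightarrow> B i \<subseteq> carrier G"
    and "\<eta> \<ge> 0"
    and large: "\<And>i. i \<in> I \<Longrightarrow>
      real (card I) < \<eta>\<^sup>2 * density G C * density G (A i) * density G (B i) * k"
  shows "\<exists>z\<in>C. \<forall>i\<in>I.
    (1 - \<eta>) * (density G (A i) * density G (B i)) \<le> density G {y \<in> A i. z \<otimes> y \<in> B i}"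
proof (rule ccontr)
  assume contr: "\<not> ?thesis"
  define bad where "bad = (\<lambda>i. {x \<in> carrier G.
    density G {y \<in> A i. x \<otimes> y \<in> B i} < (1 - \<eta>) * (density G (A i) * density G (B i))})"
  have bad: "density G (bad i) < density G C / real (card I)" if i: "i \<in> I" for i
  proof -
    have "density G (A i) \<noteq> 0" "density G (B i) \<noteq> 0"
      using large[OF i] by auto
    then have pos: "density G (A i) > 0" "density G (B i) > 0"
      using density_nonneg[of G "A i"] density_nonneg[of G "B i"] by auto
    define P where "P = \<eta>\<^sup>2 * density G (A i) * density G (B i) * k"
    have P: "real (card I) < P * density G C"
      using large[OF i] by (simp add: P_def algebra_simps)
    have "P > 0"
    proof -
      have "P \<noteq> 0" using P by auto
      moreover have "P \<ge> 0"
        using pos \<open>k > 0\<close> by (simp add: P_def)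
      ultimately show ?thesis by simp
    qed
    have "density G (bad i) * P \<le> 1"
      unfolding bad_def P_def
      by (rule density_bad_translates) (use fin \<open>k > 0\<close> rep sub i pos \<open>\<eta> \<ge> 0\<close> in auto)
    then have "density G (bad i) \<le> 1 / P"
      using \<open>P > 0\<close> by (simp add: field_simps)
    also have "\<dots> < density G C / real (card I)"
      using P \<open>P > 0\<close> I by (simp add: field_simps card_gt_0_iff)
    finally show ?thesis .
  qed
  have "C \<subseteq> (\<Union>i\<in>I. bad i)"
    using contr C by (fastforce simp: bad_def not_le)
  moreover have "finite (\<Union>i\<in>I. bad i)"
    using fin I(1) by (simp add: bad_def)
  ultimately have "card C \<le> card (\<Union>i\<in>I. bad i)"
    by (intro card_mono)
  also have "\<dots> \<le> (\<Sum>i\<in>I. card (bad i))"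
    by (rule card_UN_le[OF I(1)])
  finally have "real (card C) \<le> (\<Sum>i\<in>I. real (card (bad i)))"
    by (simp flip: of_nat_sum)
  then have "density G C \<le> (\<Sum>i\<in>I. density G (bad i))"
    unfolding density_def sum_divide_distrib[symmetric] by (rule divide_right_mono) simp
  also have "\<dots> < (\<Sum>i\<in>I. density G C / real (card I))"
    using I bad by (intro sum_strict_mono) auto
  also have "\<dots> = density G C"
    using I by simp
  finally show False by simp
qed

end

section \<open>Ordered products and the sets of admissible extensions\<close>

lemma all_subset_atLeastAtMost_Suc:
  "(\<forall>U\<subseteq>{1..Suc j}. P U) \<longleftrightarrow> (\<forall>U\<subseteq>{1..j}. P U \<and> P (insert (Suc j) U))"
proof -
  have "(\<forall>U\<in>Pow {1..Suc j}. P U) \<longleftrightarrow> (\<forall>U\<in>Pow {1..j}. P U \<and> P (insert (Suc j) U))"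
    by (auto simp: atLeastAtMostSuc_conv Pow_insert)
  then show ?thesis
    by (simp only: Ball_def Pow_iff)
qed

context group
begin

lemma ordered_prod_empty: "ordered_prod G x {} = \<one>"
  by (simp add: ordered_prod_def)

lemma foldr_mult_closed:
  "x ` set js \<subseteq> carrier G \<Longrightarrow> foldr (\<otimes>) (map x js) \<one> \<in> carrier G"
  by (induction js) auto

lemma foldr_mult_snoc:
  "x ` set js \<subseteq> carrier G \<Longrightarrow> a \<in> carrier G \<Longrightarrow>
    foldr (\<otimes>) (map x js @ [a]) \<one> = foldr (\<otimes>) (map x js) \<one> \<otimes> a"
  by (induction js) (auto simp: m_assoc foldr_mult_closed simp del: foldr_append)

lemma ordered_prod_closed:
  assumes "finite U" and "x ` U \<subseteq> carrier G"
  shows "ordered_prod G x U \<in> carrier G"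
  unfolding ordered_prod_def by (rule foldr_mult_closed) (use assms in simp)

text \<open>\<open>Suc j\<close> exceeds every member of \<open>U\<close>, so its factor comes last.
  The product is nested to the right, so splitting off the last factor takes associativity.\<close>

lemma ordered_prod_insert:
  assumes "U \<subseteq> {1..j}" and "x ` U \<subseteq> carrier G" and "z \<in> carrier G"
  shows "ordered_prod G (x(Suc j := z)) (insert (Suc j) U) = ordered_prod G x U \<otimes> z"
proof -
  have U: "finite U" "Suc j \<notin> U"
    using assms(1) finite_subset[OF assms(1)] by auto
  have "sorted_list_of_set (insert (Suc j) U) = sorted_list_of_set U @ [Suc j]"
    using U assms(1) by (auto simp: sorted_list_of_set_insert intro!: sorted_insort_is_snoc)
  moreover have "map (x(Suc j := z)) (sorted_list_of_set U) = map x (sorted_list_of_set U)"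
    using U by (intro map_cong) auto
  ultimately show ?thesis
    unfolding ordered_prod_def using foldr_mult_snoc[of x "sorted_list_of_set U" z] U assms
    by simp
qed

lemma ordered_prod_update:
  assumes "U \<subseteq> {1..j}"
  shows "ordered_prod G (x(Suc j := z)) U = ordered_prod G x U"
proof -
  have "finite U" "Suc j \<notin> U"
    using assms finite_subset[OF assms] by auto
  then show ?thesis
    unfolding ordered_prod_def by (intro arg_cong2[where f = "\<lambda>xs. foldr (\<otimes>) xs"] map_cong) auto
qed

text \<open>The values that \<open>x\<^sub>F\<close> may take, for \<open>F\<close> beyond \<open>j\<close>, once \<open>x\<^sub>1, \<dots>, x\<^sub>j\<close> are fixed.\<close>

definition extensions :: "(nat set \<Rightarrow> 'a set) \<Rightarrow> (nat \<Rightarrow> 'a) \<Rightarrow> nat \<Rightarrow> nat set \<Rightarrow> 'a set" where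
  "extensions A x j F = {y \<in> carrier G. \<forall>U\<subseteq>{1..j}. ordered_prod G x U \<otimes> y \<in> A (U \<union> F)}"

lemma extensions_0: "A F \<subseteq> carrier G \<Longrightarrow> extensions A x 0 F = A F"
  by (auto simp: extensions_def ordered_prod_empty)

lemma extensions_subset: "extensions A x j F \<subseteq> carrier G"
  by (auto simp: extensions_def)

text \<open>The subsets containing \<open>Suc j\<close> demand that \<open>z \<otimes> y\<close> be
  admissible for \<open>insert (Suc j) F\<close>. The new set thus has the form treated by
  \<open>good_translate_exists\<close>.\<close>

lemma extensions_Suc:
  assumes x: "\<And>i. i \<in> {1..j} \<Longrightarrow> x i \<in> carrier G" and z: "z \<in> carrier G"
  shows "extensions A (x(Suc j := z)) (Suc j) F =
    {y \<in> extensions A x j F. z \<otimes> y \<in> extensions A x j (insert (Suc j) F)}"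
proof -
  have closed: "ordered_prod G x U \<in> carrier G" "x ` U \<subseteq> carrier G" if "U \<subseteq> {1..j}" for U
  proof -
    show "x ` U \<subseteq> carrier G" using x that by blast
    then show "ordered_prod G x U \<in> carrier G"
      using finite_subset[OF that] by (intro ordered_prod_closed) auto
  qed
  have "y \<in> extensions A (x(Suc j := z)) (Suc j) F \<longleftrightarrow>
      y \<in> extensions A x j F \<and> z \<otimes> y \<in> extensions A x j (insert (Suc j) F)"
    if "y \<in> carrier G" for y
    unfolding extensions_def mem_Collect_eq all_subset_atLeastAtMost_Suc
    using that z closed
    by (auto simp: ordered_prod_update ordered_prod_insert m_assoc)
  then show ?thesis
    using extensions_subset by blast
qed

text \<open>Index sets without \<open>Suc j\<close> do not see the update; for the others,
  membership of \<open>z\<close> in the extensions of \<open>{Suc j}\<close> is exactly the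
  condition needed.\<close>

lemma ordered_prods_mem_Suc:
  assumes x: "\<And>i. i \<in> {1..j} \<Longrightarrow> x i \<in> carrier G"
    and A: "\<And>U. U \<noteq> {} \<Longrightarrow> U \<subseteq> {1..j} \<Longrightarrow> ordered_prod G x U \<in> A U"
    and z: "z \<in> extensions A x j {Suc j}"
    and U: "U \<noteq> {}" "U \<subseteq> {1..Suc j}"
  shows "ordered_prod G (x(Suc j := z)) U \<in> A U"
proof (cases "Suc j \<in> U")
  case False
  with U have "U \<subseteq> {1..j}"
    using atLeastAtMostSuc_conv[of 1 j] by auto
  with A[OF U(1)] show ?thesis by (simp add: ordered_prod_update)
next
  case True
  define U' where "U' = U - {Suc j}"
  have U': "U' \<subseteq> {1..j}" "U = insert (Suc j) U'"
    using U True atLeastAtMostSuc_conv[of 1 j] by (auto simp: U'_def)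
  have "x ` U' \<subseteq> carrier G" using x U' by blast
  then have "ordered_prod G (x(Suc j := z)) U = ordered_prod G x U' \<otimes> z"
    unfolding U'(2) using U'(1) z by (intro ordered_prod_insert) (auto simp: extensions_def)
  then show ?thesis
    using z U' by (simp add: extensions_def)
qed

end

section \<open>Products of densities and the density condition\<close>

definition density_prod :: "('a, 'b) monoid_scheme \<Rightarrow> (nat set \<Rightarrow> 'a set) \<Rightarrow> nat \<Rightarrow> nat set \<Rightarrow> real" where
  "density_prod G A j F = (\<Prod>U\<in>Pow {1..j}. density G (A (U \<union> F)))"

lemma density_prod_0: "density_prod G A 0 F = density G (A F)"
  by (simp add: density_prod_def)

lemma density_prod_nonneg: "density_prod G A j F \<ge> 0"
  by (simp add: density_prod_def prod_nonneg density_nonneg)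

text \<open>The counterpart of \<open>extensions_Suc\<close>: \<open>density_prod\<close> is the
  density that \<open>extensions\<close> would have if all its conditions were independent.\<close>

lemma density_prod_Suc:
  "density_prod G A (Suc j) F = density_prod G A j F * density_prod G A j (insert (Suc j) F)"
proof -
  have "Pow {1..Suc j} = Pow {1..j} \<union> insert (Suc j) ` Pow {1..j}"
    by (simp add: atLeastAtMostSuc_conv Pow_insert)
  moreover have "Pow {1..j} \<inter> insert (Suc j) ` Pow {1..j} = {}"
    by auto
  moreover have "inj_on (insert (Suc j)) (Pow {1..j})"
  proof (rule inj_onI)
    fix U V
    assume *: "U \<in> Pow {1..j}" "V \<in> Pow {1..j}" "insert (Suc j) U = insert (Suc j) V"
    then have "Suc j \<notin> U" "Suc j \<notin> V" by auto
    with *(3) show "U = V" by (simp add: insert_ident)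
  qed
  ultimately show ?thesis
    by (simp add: density_prod_def prod.union_disjoint prod.reindex)
qed

text \<open>With \<open>h = Suc j\<close>, a member \<open>U \<union> V\<close> determines
  \<open>U\<close> and \<open>V\<close> by cutting at \<open>j\<close>, and the three choices of
  \<open>V\<close> are distinct. So the product splits into three blocks.\<close>

lemma prod_index_family:
  assumes "E \<noteq> {}" and "E \<subseteq> {Suc (Suc j)..m}"
  shows "(\<Prod>F\<in>index_family (Suc j) E. density G (A F)) =
    density_prod G A j {Suc j} * density_prod G A j E * density_prod G A j (insert (Suc j) E)"
proof -
  define \<V> where "\<V> = {{Suc j}, E, insert (Suc j) E}"
  have \<V>: "V \<inter> {1..j} = {}" if "V \<in> \<V>" for V
    using that assms(2) by (auto simp: \<V>_def)
  have "Suc j \<notin> E" using assms(2) by auto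
  then have distinct: "{Suc j} \<noteq> E" "{Suc j} \<noteq> insert (Suc j) E" "E \<noteq> insert (Suc j) E"
    using assms(1) by auto
  have "index_family (Suc j) E = (\<lambda>(U, V). U \<union> V) ` (Pow {1..j} \<times> \<V>)"
    by (auto simp: index_family_def \<V>_def atLeastLessThanSuc_atLeastAtMost)
  moreover have "inj_on (\<lambda>(U, V). U \<union> V) (Pow {1..j} \<times> \<V>)"
  proof (intro inj_onI, clarify)
    fix U V U' V'
    assume *: "U \<subseteq> {1..j}" "U' \<subseteq> {1..j}" "V \<in> \<V>" "V' \<in> \<V>" "U \<union> V = U' \<union> V'"
    then have "(U \<union> V) \<inter> {1..j} = U" "(U' \<union> V') \<inter> {1..j} = U'"
      "(U \<union> V) - {1..j} = V" "(U' \<union> V') - {1..j} = V'"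
      using \<V>[of V] \<V>[of V'] by auto
    with *(5) show "U = U' \<and> V = V'" by metis
  qed
  ultimately have "(\<Prod>F\<in>index_family (Suc j) E. density G (A F)) =
      (\<Prod>U\<in>Pow {1..j}. \<Prod>V\<in>\<V>. density G (A (U \<union> V)))"
    by (simp add: prod.reindex prod.cartesian_product case_prod_unfold o_def)
  also have "\<dots> = (\<Prod>U\<in>Pow {1..j}. density G (A (U \<union> {Suc j})) *
      density G (A (U \<union> E)) * density G (A (U \<union> insert (Suc j) E)))"
    using distinct by (simp add: \<V>_def mult.assoc)
  finally show ?thesis by (simp add: density_prod_def prod.distrib)
qed

section \<open>The choice of the elements one after the other\<close>

lemma density_loss_bound:
  assumes "Suc j < m"
  shows "(1 / 2) ^ Suc j \<le> (1 - 1 / 2 ^ m :: real) ^ (3 * (2 ^ j - 1))"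
proof -
  \<comment> \<open>Bernoulli's inequality reduces the claim to this linear one. For
    \<open>j = 0\<close> the exponent is 0; otherwise \<open>j + 2 \<le> m\<close> keeps the loss
    below 3/4, while the left side is at most 1/4.\<close>
  have "(1 / 2) ^ Suc j \<le> 1 - real (3 * (2 ^ j - 1)) / 2 ^ m"
  proof (cases j)
    case (Suc i)
    have "(2::real) ^ (j + 2) \<le> 2 ^ m"
      using assms by (intro power_increasing) auto
    then have "real (3 * (2 ^ j - 1)) / 2 ^ m \<le> 3 / 4"
      by (simp add: field_simps power_add)
    moreover have "(1 / 2 :: real) ^ Suc j \<le> (1 / 2) ^ 2"
      using Suc by (intro power_decreasing) auto
    moreover have "(1 / 2 :: real) ^ 2 = 1 / 4"
      by (simp add: power2_eq_square)
    ultimately show ?thesis by linarith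
  qed simp
  also have "\<dots> = 1 + real (3 * (2 ^ j - 1)) * (- 1 / 2 ^ m)"
    by simp
  also have "\<dots> \<le> (1 + - 1 / 2 ^ m) ^ (3 * (2 ^ j - 1))"
    by (rule Bernoulli_inequality) simp
  finally show ?thesis by simp
qed

text \<open>The density bound is the invariant that lets the next element be found. Choosing the
  element with index \<open>Suc j\<close> takes the density condition at \<open>h = Suc j\<close>,
  hence the restriction \<open>j < m\<close>.\<close>

lemma (in group) extensions_induction:
  fixes A :: "nat set \<Rightarrow> 'a set"
  assumes fin: "finite (carrier G)" and "k > 0"
    and rep: "\<And>d \<rho>. nontrivial_representation G d \<rho> \<Longrightarrow> k \<le> real d"
    and A: "\<And>F. F \<noteq> {} \<Longrightarrow> F \<subseteq> {1..m} \<Longrightarrow> A F \<subseteq> carrier G"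
    and dense: "density_condition G m k A"
    and "j < m"
  shows "\<exists>x. (\<forall>i\<in>{1..j}. x i \<in> carrier G) \<and>
    (\<forall>U. U \<noteq> {} \<longrightarrow> U \<subseteq> {1..j} \<longrightarrow> ordered_prod G x U \<in> A U) \<and>
    (\<forall>F. F \<noteq> {} \<longrightarrow> F \<subseteq> {Suc j..m} \<longrightarrow>
      (1 - 1 / 2 ^ m) ^ (2 ^ j - 1) * density_prod G A j F \<le> density G (extensions A x j F))"
  using \<open>j < m\<close>
proof (induction j)
  case 0
  show ?case
    using A by (intro exI[of _ "\<lambda>_. \<one>"]) (auto simp: extensions_0 density_prod_0)
next
  case (Suc j)
  define \<eta> :: real where "\<eta> = 1 / 2 ^ m"
  have \<eta>: "\<eta> > 0" "1 - \<eta> \<ge> 0" by (simp_all add: \<eta>_def)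
  define a :: nat where "a = 2 ^ j - 1"
  from Suc obtain x where x: "\<And>i. i \<in> {1..j} \<Longrightarrow> x i \<in> carrier G"
    and xA: "\<And>U. U \<noteq> {} \<Longrightarrow> U \<subseteq> {1..j} \<Longrightarrow> ordered_prod G x U \<in> A U"
    and ext: "\<And>F. F \<noteq> {} \<Longrightarrow> F \<subseteq> {Suc j..m} \<Longrightarrow>
      (1 - \<eta>) ^ a * density_prod G A j F \<le> density G (extensions A x j F)"
    unfolding \<eta>_def a_def by (meson Suc_lessD)
  define C where "C = extensions A x j"
  define I where "I = Pow {Suc (Suc j)..m} - {{}}"
  have I_D: "E \<noteq> {} \<and> E \<subseteq> {Suc (Suc j)..m}" if "E \<in> I" for E
    using that by (auto simp: I_def)
  have "finite I" by (simp add: I_def)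
  have "{m} \<in> I" using Suc.prems by (auto simp: I_def)
  \<comment> \<open>Leaving out the empty set makes the inequality strict, as
    \<open>good_translate_exists\<close> demands.\<close>
  have card_I: "real (card I) < 2 ^ (m - Suc j)"
  proof -
    have "card I < card (Pow {Suc (Suc j)..m})"
      by (rule psubset_card_mono) (auto simp: I_def)
    then have "card I < 2 ^ (m - Suc j)"
      by (simp add: card_Pow)
    then have "real (card I) < real (2 ^ (m - Suc j))"
      by (simp only: of_nat_less_iff)
    then show ?thesis by simp
  qed
  have cube: "c ^ (3 * i) = c ^ i * c ^ i * c ^ i" for c :: real and i
  proof -
    have "3 * i = i + i + i" by simp
    then show ?thesis by (simp only: power_add)
  qed
  have large: "real (card I) < \<eta>\<^sup>2 * density G (C {Suc j}) * density G (C E) *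
      density G (C (insert (Suc j) E)) * k" if "E \<in> I" for E
  proof -
    let ?D = "density_prod G A j"
    have E: "E \<noteq> {}" "E \<subseteq> {Suc (Suc j)..m}" using I_D[OF that] by auto
    have "hE_density_condition G m k A (Suc j) E"
      using dense E Suc.prems by (auto simp: density_condition_def)
    then have D: "2 ^ (3 * m) / k \<le> ?D {Suc j} * ?D E * ?D (insert (Suc j) E)"
      by (simp add: hE_density_condition_def prod_index_family[OF E])
    \<comment> \<open>The constants are matched here: \<open>\<eta>\<^sup>2\<close> times
      \<open>2 ^ (3 * m)\<close> is \<open>2 ^ m\<close>, and the losses of the three densities cost
      at most a factor \<open>2 ^ Suc j\<close>. What remains still exceeds
      \<open>card I\<close>.\<close>
    have "2 ^ (m - Suc j) = (2 ^ m * (1 / 2) ^ Suc j :: real)"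
      using Suc.prems by (simp add: power_diff power_one_over field_simps)
    also have "\<dots> \<le> 2 ^ m * (1 - \<eta>) ^ (3 * a)"
      unfolding \<eta>_def a_def by (intro mult_left_mono density_loss_bound Suc.prems) simp
    also have "\<dots> = \<eta>\<^sup>2 * ((1 - \<eta>) ^ (3 * a) * (2 ^ (3 * m) / k)) * k"
      using \<open>k > 0\<close> by (simp add: \<eta>_def power2_eq_square cube[of 2])
    also have "\<dots> \<le> \<eta>\<^sup>2 * ((1 - \<eta>) ^ (3 * a) * (?D {Suc j} * ?D E * ?D (insert (Suc j) E))) * k"
      using \<eta> \<open>k > 0\<close> by (intro mult_left_mono mult_right_mono D) auto
    also have "\<dots> = \<eta>\<^sup>2 * (((1 - \<eta>) ^ a * ?D {Suc j}) * ((1 - \<eta>) ^ a * ?D E) *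
        ((1 - \<eta>) ^ a * ?D (insert (Suc j) E))) * k"
      unfolding cube by (simp only: mult_ac)
    also have "\<dots> \<le> \<eta>\<^sup>2 * (density G (C {Suc j}) * density G (C E) *
        density G (C (insert (Suc j) E))) * k"
      unfolding C_def using \<eta> E Suc.prems \<open>k > 0\<close>
      by (intro mult_left_mono mult_right_mono mult_mono ext mult_nonneg_nonneg density_nonneg
          density_prod_nonneg zero_le_power) auto
    finally show ?thesis
      using less_le_trans[OF card_I] by (simp only: mult.assoc)
  qed
  have "\<exists>z\<in>C {Suc j}. \<forall>E\<in>I. (1 - \<eta>) * (density G (C E) * density G (C (insert (Suc j) E)))
      \<le> density G {y \<in> C E. z \<otimes> y \<in> C (insert (Suc j) E)}"
    using large \<open>{m} \<in> I\<close> \<eta>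
    by (intro good_translate_exists[OF fin \<open>k > 0\<close> rep \<open>finite I\<close>])
      (auto simp: C_def extensions_subset)
  then obtain z where z: "z \<in> C {Suc j}" and good: "\<And>E. E \<in> I \<Longrightarrow>
      (1 - \<eta>) * (density G (C E) * density G (C (insert (Suc j) E)))
      \<le> density G {y \<in> C E. z \<otimes> y \<in> C (insert (Suc j) E)}"
    by blast
  have z_carrier: "z \<in> carrier G" using z by (simp add: C_def extensions_def)
  have step: "extensions A (x(Suc j := z)) (Suc j) F =
      {y \<in> extensions A x j F. z \<otimes> y \<in> extensions A x j (insert (Suc j) F)}" for F
    by (rule extensions_Suc[OF x z_carrier])
  have dense_Suc: "(1 - \<eta>) ^ (2 ^ Suc j - 1) * density_prod G A (Suc j) E
      \<le> density G (extensions A (x(Suc j := z)) (Suc j) E)" if "E \<in> I" for E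
  proof -
    have E: "E \<noteq> {}" "E \<subseteq> {Suc (Suc j)..m}" using I_D[OF that] by auto
    \<comment> \<open>Each of the two densities carries the exponent \<open>a\<close>, and the new
      translate adds one more factor \<open>1 - \<eta>\<close>.\<close>
    have exponent: "2 ^ Suc j - 1 = Suc (a + a)"
    proof -
      have "(1::nat) \<le> 2 ^ j" by simp
      then show ?thesis unfolding a_def power_Suc by linarith
    qed
    have "(1 - \<eta>) ^ (2 ^ Suc j - 1) * density_prod G A (Suc j) E =
        (1 - \<eta>) * (((1 - \<eta>) ^ a * density_prod G A j E) *
          ((1 - \<eta>) ^ a * density_prod G A j (insert (Suc j) E)))"
      unfolding exponent density_prod_Suc by (simp add: power_add mult_ac)
    also have "\<dots> \<le> (1 - \<eta>) * (density G (C E) * density G (C (insert (Suc j) E)))"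
      unfolding C_def using \<eta> E Suc.prems
      by (intro mult_left_mono mult_mono ext mult_nonneg_nonneg density_nonneg
          density_prod_nonneg zero_le_power) auto
    also have "\<dots> \<le> density G (extensions A (x(Suc j := z)) (Suc j) E)"
      using good[OF that] unfolding step C_def .
    finally show ?thesis .
  qed
  have "(x(Suc j := z)) i \<in> carrier G" if "i \<in> {1..Suc j}" for i
    using that x z_carrier by auto
  moreover have "ordered_prod G (x(Suc j := z)) U \<in> A U" if "U \<noteq> {}" "U \<subseteq> {1..Suc j}" for U
    by (rule ordered_prods_mem_Suc[OF x xA z[unfolded C_def] that])
  moreover have "F \<in> I" if "F \<noteq> {}" "F \<subseteq> {Suc (Suc j)..m}" for F
    using that by (simp add: I_def)
  ultimately show ?case
    using dense_Suc unfolding \<eta>_def by blast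
qed

theorem theorem5p3:
  fixes G :: "('a, 'b) monoid_scheme" and m n :: nat and k :: real and A :: "nat set \<Rightarrow> 'a set"
  assumes "m \<ge> 2" and "k > 0"
    and "group G" and "finite (carrier G)" and "order G = n"
    and "\<And>d \<rho>. nontrivial_representation G d \<rho> \<Longrightarrow> \<not> real d < k"
    and "\<And>F. F \<noteq> {} \<Longrightarrow> F \<subseteq> {1..m} \<Longrightarrow> A F \<subseteq> carrier G"
    and "density_condition G m k A"
  shows "\<exists>x. (\<forall>i\<in>{1..m}. x i \<in> carrier G) \<and>
    (\<forall>F. F \<noteq> {} \<and> F \<subseteq> {1..m} \<longrightarrow> ordered_prod G x F \<in> A F)"
proof -
  interpret group G by fact
  \<comment> \<open>The induction reaches \<open>m - 1\<close>, which is \<open>Suc j\<close> here.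
    For the last element it suffices that the extensions of \<open>{m}\<close> form a non-empty
    set.\<close>
  obtain j where m: "m = Suc (Suc j)"
    by (rule that[of "m - 2"]) (use \<open>m \<ge> 2\<close> in simp)
  have rep: "k \<le> real d" if "nontrivial_representation G d \<rho>" for d \<rho>
    using assms(6)[OF that] by simp
  have "Suc j < m" by (simp add: m)
  have "\<exists>x. (\<forall>i\<in>{1..Suc j}. x i \<in> carrier G) \<and>
      (\<forall>U. U \<noteq> {} \<longrightarrow> U \<subseteq> {1..Suc j} \<longrightarrow> ordered_prod G x U \<in> A U) \<and>
      (\<forall>F. F \<noteq> {} \<longrightarrow> F \<subseteq> {Suc (Suc j)..m} \<longrightarrow>
        (1 - 1 / 2 ^ m) ^ (2 ^ Suc j - 1) * density_prod G A (Suc j) F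
          \<le> density G (extensions A x (Suc j) F))"
    (is "\<exists>x. ?closed x \<and> ?prods x \<and> ?dense x")
    by (rule extensions_induction) (fact assms rep \<open>Suc j < m\<close>)+
  then obtain x where *: "?closed x" "?prods x" "?dense x"
    by blast
  have x: "\<And>i. i \<in> {1..Suc j} \<Longrightarrow> x i \<in> carrier G"
    and xA: "\<And>U. U \<noteq> {} \<Longrightarrow> U \<subseteq> {1..Suc j} \<Longrightarrow> ordered_prod G x U \<in> A U"
    using *(1,2) by simp_all
  \<comment> \<open>At \<open>h = m - 1\<close> and \<open>E = {m}\<close> the density condition
    makes a product positive that has \<open>density_prod G A (Suc j) {m}\<close> as a
    factor.\<close>
  have "hE_density_condition G m k A (Suc j) {m}"
    using assms(8) by (auto simp: density_condition_def m)
  then have "2 ^ (3 * m) / k \<le> density_prod G A j {Suc j} * density_prod G A (Suc j) {m}"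
    using prod_index_family[of "{m}" j m G A]
    by (simp add: hE_density_condition_def density_prod_Suc m mult.assoc)
  moreover have "2 ^ (3 * m) / k > 0" using \<open>k > 0\<close> by simp
  ultimately have "density_prod G A (Suc j) {m} \<noteq> 0" by auto
  then have "density_prod G A (Suc j) {m} > 0"
    using density_prod_nonneg[of G A "Suc j" "{m}"] by simp
  moreover have "(1 - 1 / 2 ^ m :: real) > 0"
    using one_less_power[of "2 :: real" m] \<open>m \<ge> 2\<close> by simp
  ultimately have "0 < (1 - 1 / 2 ^ m) ^ (2 ^ Suc j - 1) * density_prod G A (Suc j) {m}"
    by (intro mult_pos_pos zero_less_power)
  also have "\<dots> \<le> density G (extensions A x (Suc j) {m})"
    using *(3) by (simp add: m)
  finally have "extensions A x (Suc j) {m} \<noteq> {}"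
    by (auto simp: density_def)
  then obtain z where z: "z \<in> extensions A x (Suc j) {Suc (Suc j)}"
    by (auto simp: m)
  then have "z \<in> carrier G" by (simp add: extensions_def)
  have "(x(m := z)) i \<in> carrier G" if "i \<in> {1..m}" for i
    using that x \<open>z \<in> carrier G\<close> by (auto simp: m)
  moreover have "ordered_prod G (x(m := z)) F \<in> A F" if "F \<noteq> {}" "F \<subseteq> {1..m}" for F
    unfolding m by (rule ordered_prods_mem_Suc[OF x xA z]) (use that in \<open>auto simp: m\<close>)
  ultimately show ?thesis by blast
qed

end
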